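(* For every odd $q\in\mathbb{N}$, every graph containing the complete graph $K_{2q+2}$ as a minor contains a cycle of length divisible by $q$.
   Context: Graphs are undirected and simple; $K_m$ denotes the complete graph on $m$ vertices, and minors are in the usual graph-theoretic sense. *)

theory Defs
  imports "Graph_Theory.Graph_Theory"
begin

text \<open>
  An undirected simple graph is represented, as usual in this library, by a symmetric digraph
  without loops and parallel arcs: the edge \<open>{u,v}\<close> is the pair of opposite arcs between
  \<open>u\<close> and \<open>v\<close>. In contrast to the library's locale \<open>graph\<close>, finiteness is not required.
\<close>

locale simple_graph = sym_digraph + loopfree_digraph + nomulti_digraph

text \<open>
  \<open>H\<close> is a minor of \<open>G\<close>: \<open>G\<close> contains a model of \<open>H\<close>, whose branch sets \<open>B x\<close> are pairwise
  disjoint and connected. They are non-empty because \<open>connected\<close> excludes the null graph.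
\<close>

definition minor_of :: "('c,'d) pre_digraph \<Rightarrow> ('a,'b) pre_digraph \<Rightarrow> bool" where
  "minor_of H G \<longleftrightarrow> (\<exists>B.
      (\<forall>x\<in>verts H. B x \<subseteq> verts G \<and> connected (G \<restriction> B x)) \<and>
      (\<forall>x\<in>verts H. \<forall>y\<in>verts H. x \<noteq> y \<longrightarrow> B x \<inter> B y = {}) \<and>
      (\<forall>x y. x \<rightarrow>\<^bsub>H\<^esub> y \<longrightarrow> (\<exists>u\<in>B x. \<exists>v\<in>B y. u \<rightarrow>\<^bsub>G\<^esub> v)))"

text \<open>
  A directed cycle of a symmetric digraph may traverse an edge back and forth (\<open>a, b, a\<close>);
  requiring at least three arcs excludes exactly this case, as loops are absent.
\<close>

definition undirected_cycle :: "('a,'b) pre_digraph \<Rightarrow> 'b awalk \<Rightarrow> bool" where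
  "undirected_cycle G p \<longleftrightarrow> pre_digraph.cycle G p \<and> 3 \<le> length p"

end

theory Submission
  imports Defs
begin

text \<open>
  Group the \<open>2q + 2\<close> branch sets into \<open>q + 1\<close> pairs \<open>(A i, B i)\<close> and fix an edge \<open>f i\<close> from \<open>A i\<close> to
  \<open>B i\<close>. A walk from the head of \<open>f i\<close> through \<open>B i\<close> and \<open>A j\<close> to the head of \<open>f j\<close> is an arc
  \<open>(i, j)\<close>, labelled by its length, of a complete digraph on \<open>q + 1\<close> vertices, and directed cycles of
  this digraph give cycles of the graph. It remains to find a directed cycle whose labels sum to
  zero modulo the odd number \<open>q\<close>.

  To this end absorb the vertices one by one into a set of inner vertices of paths towards a root.
  Each remaining vertex \<open>z\<close> keeps the set \<open>P z\<close> of residues realised by its paths to the root, and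
  absorbing \<open>x\<close> enlarges \<open>P z\<close> by \<open>w z x + P x\<close>. If each absorption adds a residue to every
  \<open>P z\<close>, then finally some \<open>P z\<close> contains all residues and the arc from the root to \<open>z\<close> closes a
  zero-sum cycle. Otherwise every \<open>x\<close> has some \<open>z = b x\<close> with \<open>P z = w z x + P x\<close>, and along a
  cycle of \<open>b\<close> the labels sum to an element of the stabiliser \<open>d\<int>\<close> of \<open>P x\<close>. If \<open>d = q\<close>, this
  cycle has sum zero. If \<open>d < q\<close>, then \<open>h = q / d \<ge> 3\<close> because \<open>q\<close> is odd; letting all vertices
  enter through \<open>x\<close> (or through \<open>b x\<close>) one can spend three vertices to gain \<open>h\<close> residues, unless all
  labels are multiples of \<open>d\<close> up to a potential, and then induction applies to \<open>h\<close>.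
\<close>

subsection \<open>Periodic sets of integers\<close>

definition shift :: "int \<Rightarrow> int set \<Rightarrow> int set" where
  "shift g A = {r. r - g \<in> A}"

text \<open>Residue sets modulo \<open>q\<close> are encoded as \<open>q\<close>-periodic sets of
  integers, so that divisors of \<open>q\<close> can be periods of the same set. For these sets this
  counts residues.\<close>

definition density :: "int \<Rightarrow> int set \<Rightarrow> int" where
  "density q A = int (card (A \<inter> {0..<q}))"

lemma mem_shift [simp]: "r \<in> shift g A \<longleftrightarrow> r - g \<in> A"
  by (simp add: shift_def)

lemma shift_0 [simp]: "shift 0 A = A"
  by (simp add: shift_def)

lemma shift_shift [simp]: "shift g (shift h A) = shift (g + h) A"
  by (auto simp: shift_def algebra_simps)

lemma shift_Un: "shift g (A \<union> B) = shift g A \<union> shift g B"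
  by (auto simp: shift_def)

lemma shift_eq_iff: "shift g A = shift h B \<longleftrightarrow> shift (g - h) A = B"
proof
  assume "shift g A = shift h B"
  then have "shift (-h) (shift g A) = shift (-h) (shift h B)" by simp
  then show "shift (g - h) A = B" by simp
next
  assume "shift (g - h) A = B"
  then have "shift h (shift (g - h) A) = shift h B" by simp
  then show "shift g A = shift h B" by simp
qed

lemma shift_mult:
  assumes "shift q A = A"
  shows "shift (q * n) A = A"
proof -
  have nat: "shift (q * int m) A = A" for m
  proof (induction m)
    case (Suc m)
    have "shift (q * int (Suc m)) A = shift q (shift (q * int m) A)"
      by (simp add: algebra_simps)
    with Suc assms show ?case by simp
  qed simp
  show ?thesis
  proof (cases "n \<ge> 0")
    case True
    with nat[of "nat n"] show ?thesis by simp
  next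
    case False
    with nat[of "nat (- n)"] have "shift (q * n) A = shift (q * n) (shift (- (q * n)) A)" by simp
    then show ?thesis by (simp only: shift_shift) simp
  qed
qed

lemma shift_dvd: "shift d A = A \<Longrightarrow> d dvd g \<Longrightarrow> shift g A = A"
  by (metis dvd_def shift_mult)

lemma mem_mod_iff:
  assumes "shift q A = A"
  shows "a mod q \<in> A \<longleftrightarrow> a \<in> A"
proof -
  have "a \<in> shift (q * (a div q)) A \<longleftrightarrow> a \<in> A"
    by (simp only: shift_mult[OF assms])
  then show ?thesis by (simp add: minus_mult_div_eq_mod)
qed

text \<open>The stabiliser is a subgroup of the integers containing \<open>q\<close>, so its least
  positive element generates it.\<close>

lemma stabilizer_generator:
  assumes "0 < q" "shift q A = A"
  obtains d where "0 < d" "\<And>g. shift g A = A \<longleftrightarrow> d dvd g"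
proof -
  define Q where "Q = (\<lambda>n::nat. 0 < n \<and> shift (int n) A = A)"
  define n where "n = Least Q"
  have "Q (nat q)" using assms by (simp add: Q_def)
  then have "Q n" unfolding n_def by (rule LeastI)
  then have n: "0 < n" "shift (int n) A = A" by (simp_all only: Q_def)
  have gen: "int n dvd g" if g: "shift g A = A" for g
  proof (rule ccontr)
    assume "\<not> int n dvd g"
    then have pos: "0 < g mod int n"
      using n(1) by (metis dvd_eq_mod_eq_0 of_nat_0_less_iff order_le_less pos_mod_sign)
    have "shift (int n * (g div int n)) A = A" using n(2) by (rule shift_mult)
    with g have "shift g A = shift (int n * (g div int n)) A" by simp
    then have "shift (g mod int n) A = A"
      by (simp only: shift_eq_iff minus_mult_div_eq_mod)
    then have "Q (nat (g mod int n))" using pos by (simp add: Q_def)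
    then have "n \<le> nat (g mod int n)" unfolding n_def by (rule Least_le)
    moreover have "g mod int n < int n" using n(1) by simp
    ultimately show False using pos by linarith
  qed
  show thesis
    using n(1) gen shift_dvd[OF n(2)] by (intro that[of "int n"]) (simp, blast)
qed

section \<open>Counting the residues of periodic sets\<close>

lemma density_le: "0 \<le> q \<Longrightarrow> density q A \<le> q"
  using card_mono[of "{0..<q}" "A \<inter> {0..<q}"] by (simp add: density_def)

lemma density_mono: "A \<subseteq> B \<Longrightarrow> density q A \<le> density q B"
  unfolding density_def by (simp, rule card_mono) auto

lemma density_shift [simp]:
  assumes "0 < q" "shift q A = A"
  shows "density q (shift g A) = density q A"
proof -
  note m = mem_mod_iff[OF assms(2)]
  have "bij_betw (\<lambda>a. (a + g) mod q) (A \<inter> {0..<q}) (shift g A \<inter> {0..<q})"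
  proof (rule bij_betw_byWitness[where f' = "\<lambda>a. (a - g) mod q"])
    have "(a + g) mod q - g \<in> A" if "a \<in> A" for a
    proof -
      have "((a + g) mod q - g) mod q = a mod q" by (simp add: mod_simps)
      with that m show ?thesis by metis
    qed
    then show "(\<lambda>a. (a + g) mod q) ` (A \<inter> {0..<q}) \<subseteq> shift g A \<inter> {0..<q}"
      using assms(1) by auto
    have "(a - g) mod q \<in> A" if "a - g \<in> A" for a
      using that m by blast
    then show "(\<lambda>a. (a - g) mod q) ` (shift g A \<inter> {0..<q}) \<subseteq> A \<inter> {0..<q}"
      using assms(1) by auto
  qed (auto simp: mod_simps)
  then show ?thesis unfolding density_def by (metis bij_betw_same_card)
qed

lemma density_eqD:
  assumes "shift q A = A" "shift q B = B" "0 < q" "A \<subseteq> B" "density q B \<le> density q A"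
  shows "A = B"
proof -
  have "A \<inter> {0..<q} = B \<inter> {0..<q}"
    using assms(4,5) unfolding density_def by (intro card_seteq) auto
  moreover have "a mod q \<in> B \<inter> {0..<q}" if "a \<in> B" for a
    using that mem_mod_iff[OF assms(2), of a] assms(3) by simp
  ultimately have "a mod q \<in> A" if "a \<in> B" for a
    using that by blast
  then show ?thesis using assms(4) mem_mod_iff[OF assms(1)] by blast
qed

lemma density_mult:
  assumes "0 < d" "shift d A = A" "0 \<le> h"
  shows "density (d * h) A = h * density d A"
proof -
  have "density (d * int n) A = int n * density d A" for n
  proof (induction n)
    case (Suc n)
    let ?m = "d * int n"
    have "A \<inter> {?m..<?m + d} = (+) ?m ` (A \<inter> {0..<d})"
    proof (intro equalityI subsetI)
      fix a assume a: "a \<in> A \<inter> {?m..<?m + d}"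
      then have "a \<in> shift ?m A" by (simp add: shift_mult[OF assms(2)])
      with a show "a \<in> (+) ?m ` (A \<inter> {0..<d})" by (intro image_eqI[of _ _ "a - ?m"]) auto
    next
      fix a assume "a \<in> (+) ?m ` (A \<inter> {0..<d})"
      then have "a \<in> shift ?m A \<inter> {?m..<?m + d}" by auto
      then show "a \<in> A \<inter> {?m..<?m + d}" by (simp only: shift_mult[OF assms(2)])
    qed
    then have *: "int (card (A \<inter> {?m..<?m + d})) = density d A"
      by (simp add: density_def card_image)
    have "{0..<?m + d} = {0..<?m} \<union> {?m..<?m + d}"
      using assms(1) by (intro ivl_disj_un_two(3)[symmetric]) auto
    then have "A \<inter> {0..<d * int (Suc n)} = (A \<inter> {0..<?m}) \<union> (A \<inter> {?m..<?m + d})"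
      by (simp add: algebra_simps Int_Un_distrib)
    then have "card (A \<inter> {0..<d * int (Suc n)}) = card (A \<inter> {0..<?m}) + card (A \<inter> {?m..<?m + d})"
      by (simp only:) (rule card_Un_disjoint, auto)
    with Suc * show ?case by (simp add: density_def algebra_simps)
  qed (simp add: density_def)
  from this[of "nat h"] assms(3) show ?thesis by simp
qed

text \<open>Both sets are unions of classes modulo \<open>d\<close>. A proper inclusion gains a
  whole class, which splits into \<open>h\<close> residues modulo \<open>d * h\<close>.\<close>

lemma density_less:
  assumes "0 < d" "shift d A = A" "shift d B = B" "0 \<le> h" "A \<subset> B"
  shows "density (d * h) A + h \<le> density (d * h) B"
proof -
  have "density d A < density d B"
    using assms density_eqD[of d A B] density_mono[of A B d] by force
  then have "h * (density d A + 1) \<le> h * density d B"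
    using assms(4) by (intro mult_left_mono) auto
  then show ?thesis using assms by (simp add: density_mult algebra_simps)
qed

subsection \<open>Zero-sum cycles in labelled complete digraphs\<close>

fun walk_sum :: "('v \<Rightarrow> 'v \<Rightarrow> int) \<Rightarrow> 'v list \<Rightarrow> int" where
  "walk_sum w (u # v # vs) = w u v + walk_sum w (v # vs)"
| "walk_sum w vs = 0"

definition zero_cycle :: "('v \<Rightarrow> 'v \<Rightarrow> int) \<Rightarrow> int \<Rightarrow> 'v set \<Rightarrow> bool" where
  "zero_cycle w q V \<longleftrightarrow> (\<exists>vs. set vs \<subseteq> V \<and> distinct vs \<and> 2 \<le> length vs \<and>
     q dvd walk_sum w (vs @ [hd vs]))"

text \<open>\<open>P\<close> stands for the absorbed part: a path inside \<open>V\<close> is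
  completed by any residue in \<open>P\<close> at its last vertex instead of an actual continuation
  to the root.\<close>

definition sums_from :: "('v \<Rightarrow> 'v \<Rightarrow> int) \<Rightarrow> ('v \<Rightarrow> int set) \<Rightarrow> 'v set \<Rightarrow> 'v \<Rightarrow> int set" where
  "sums_from w P V z = {r. \<exists>vs. set vs \<subseteq> V \<and> distinct vs \<and> vs \<noteq> [] \<and> hd vs = z \<and>
     r - walk_sum w vs \<in> P (last vs)}"

lemma zero_cycle_mono: "zero_cycle w q U \<Longrightarrow> U \<subseteq> V \<Longrightarrow> zero_cycle w q V"
  unfolding zero_cycle_def by blast

lemma walk_sum_append:
  "us \<noteq> [] \<Longrightarrow> walk_sum w (us @ vs) = walk_sum w us + walk_sum w (last us # vs)"
  by (induction w us rule: walk_sum.induct) simp_all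

lemma sums_fromI:
  "set vs \<subseteq> V \<Longrightarrow> distinct vs \<Longrightarrow> vs \<noteq> [] \<Longrightarrow> hd vs = z \<Longrightarrow> r - walk_sum w vs \<in> P (last vs)
    \<Longrightarrow> r \<in> sums_from w P V z"
  unfolding sums_from_def by blast

text \<open>The continuation through \<open>V - U\<close> meets \<open>U\<close> only in its first
  vertex, so appending it to a path inside \<open>U\<close> keeps the vertices distinct.\<close>

lemma sums_from_trans:
  assumes "U \<subseteq> V" "\<And>z. z \<in> U \<Longrightarrow> P' z \<subseteq> sums_from w P (insert z (V - U)) z"
  shows "sums_from w P' U z \<subseteq> sums_from w P V z"
proof
  fix r assume "r \<in> sums_from w P' U z"
  then obtain vs where vs: "set vs \<subseteq> U" "distinct vs" "vs \<noteq> []" "hd vs = z"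
    "r - walk_sum w vs \<in> P' (last vs)" unfolding sums_from_def by blast
  then have "last vs \<in> U" by auto
  with assms(2) vs(5) obtain us where us: "set us \<subseteq> insert (last vs) (V - U)" "distinct us" "us \<noteq> []"
    "hd us = last vs" "r - walk_sum w vs - walk_sum w us \<in> P (last us)"
    unfolding sums_from_def by blast
  obtain us' where us': "us = last vs # us'" using us(3,4) by (cases us) auto
  have "set us' \<inter> set vs = {}" using us(1,2) vs(1) us' by auto
  then show "r \<in> sums_from w P V z"
    using assms(1) us vs us'
    by (intro sums_fromI[of "vs @ us'"]) (auto simp: walk_sum_append last_append algebra_simps)
qed

section \<open>Cycles of a self-map of the vertices\<close>

lemma functional_cycle:
  assumes "finite V" "x \<in> V" "\<And>v. v \<in> V \<Longrightarrow> b v \<in> V"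
  obtains y m where "y \<in> V" "0 < m" "(b ^^ m) y = y" "inj_on (\<lambda>n. (b ^^ n) y) {..<m}"
proof -
  have V: "(b ^^ n) v \<in> V" if "v \<in> V" for n v
    using that assms(3) by (induction n) auto
  \<comment> \<open>The period is minimised over all points of \<open>V\<close>: a repetition within
    one period of \<open>y\<close> would then give a point of smaller period.\<close>
  define Q where "Q = (\<lambda>m. 0 < m \<and> (\<exists>y\<in>V. (b ^^ m) y = y))"
  have QI: "Q (j - i)" if "v \<in> V" "i < j" "(b ^^ i) v = (b ^^ j) v" for i j v
  proof -
    have "(b ^^ (j - i)) ((b ^^ i) v) = (b ^^ (j - i + i)) v"
      by (simp only: funpow_add comp_apply)
    also have "\<dots> = (b ^^ i) v" using that(2,3) by simp
    finally have "(b ^^ (j - i)) ((b ^^ i) v) = (b ^^ i) v" .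
    then show ?thesis using that V unfolding Q_def by (metis zero_less_diff)
  qed
  define m where "m = Least Q"
  have "range (\<lambda>n. (b ^^ n) x) \<subseteq> V" using V assms(2) by auto
  then have "\<not> inj (\<lambda>n. (b ^^ n) x)"
    using assms(1) finite_subset range_inj_infinite by blast
  then obtain i j where "i < j" "(b ^^ i) x = (b ^^ j) x"
    unfolding inj_def by (metis linorder_neqE_nat)
  then have "Q (j - i)" using QI assms(2) by blast
  then have "Q m" unfolding m_def by (rule LeastI)
  then obtain y where y: "0 < m" "y \<in> V" "(b ^^ m) y = y" unfolding Q_def by blast
  have *: False if "i < j" "j < m" "(b ^^ i) y = (b ^^ j) y" for i j
  proof -
    have "m \<le> j - i" unfolding m_def using QI[OF y(2) that(1,3)] by (rule Least_le)
    with that show False by linarith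
  qed
  have "inj_on (\<lambda>n. (b ^^ n) y) {..<m}"
  proof (rule inj_onI)
    fix i j assume "i \<in> {..<m}" "j \<in> {..<m}" "(b ^^ i) y = (b ^^ j) y"
    then show "i = j" using *[of i j] *[of j i] by (metis lessThan_iff linorder_neqE_nat)
  qed
  with y that show thesis by blast
qed

text \<open>As \<open>w (b v) v\<close> labels the arc from \<open>b v\<close> to \<open>v\<close>,
  a cycle of \<open>b\<close> is traversed backwards. The translations along it compose to the
  translation by its label sum.\<close>

lemma translation_cycle:
  assumes "finite V" "V \<noteq> {}" "\<And>v. v \<in> V \<Longrightarrow> b v \<in> V" "\<And>v. v \<in> V \<Longrightarrow> b v \<noteq> v"
    "\<And>v. v \<in> V \<Longrightarrow> shift (w (b v) v) (P v) = P (b v)"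
  obtains vs where "set vs \<subseteq> V" "distinct vs" "2 \<le> length vs"
    "shift (walk_sum w (vs @ [hd vs])) (P (hd vs)) = P (hd vs)"
proof -
  obtain y m where y: "y \<in> V" "0 < m" "(b ^^ m) y = y" "inj_on (\<lambda>n. (b ^^ n) y) {..<m}"
    using functional_cycle[of V _ b] assms(1-3) by blast
  define f where "f = (\<lambda>n. (b ^^ n) y)"
  have f: "f n \<in> V" "f 0 = y" "f (Suc n) = b (f n)" "f m = y" for n
    using y(1,3) assms(3) by (induction n) (auto simp: f_def)
  have "m \<noteq> 1" using y(1,3) assms(4)[of y] by auto
  have P: "shift (walk_sum w (rev (map f [0..<Suc n]))) (P y) = P (f n)" for n
  proof (induction n)
    case (Suc n)
    have "walk_sum w (rev (map f [0..<Suc (Suc n)]))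
      = w (b (f n)) (f n) + walk_sum w (rev (map f [0..<Suc n]))"
      by (simp add: f(3))
    then show ?case using Suc.IH assms(5)[OF f(1)[of n]] f(3)[of n] by (simp flip: shift_shift)
  qed (simp add: f)
  \<comment> \<open>With indices \<open>1\<close> to \<open>m\<close> the reversed list starts at
    \<open>f m = y\<close>, and closing it appends \<open>f 0 = y\<close>.\<close>
  define vs where "vs = rev (map f [1..<Suc m])"
  have hd: "hd vs = y" using y(2) by (simp add: vs_def f)
  have eq: "rev (map f [0..<Suc m]) = vs @ [hd vs]"
    unfolding hd unfolding vs_def using f(2) by (simp add: upt_conv_Cons del: upt_Suc)
  have "distinct (map f [0..<m])" using y(4) by (simp add: distinct_map f_def atLeast0LessThan)
  moreover have "[0..<m] = 0 # [1..<m]" using y(2) by (simp add: upt_conv_Cons)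
  ultimately have "distinct vs" using y(2) f by (auto simp: vs_def)
  moreover have "set vs \<subseteq> V" using f(1) by (auto simp: vs_def)
  moreover have "2 \<le> length vs" using y(2) \<open>m \<noteq> 1\<close> by (simp add: vs_def)
  ultimately show thesis using that P[of m] unfolding eq hd f(4) by (metis hd)
qed

section \<open>Closed walks and potentials\<close>

lemma distinct_adj_closed:
  assumes "distinct vs" "2 \<le> length vs"
  shows "distinct_adj (vs @ [hd vs])"
proof -
  have "distinct_adj vs" using assms(1) by (simp add: distinct_adj_conv_nth nth_eq_iff_index_eq)
  moreover have "last vs \<noteq> hd vs"
  proof -
    obtain u v us where us: "vs = u # v # us"
      using assms(2) by (auto simp: numeral_2_eq_2 Suc_le_length_iff)
    have "last (v # us) \<in> set (v # us)" by (rule last_in_set) simp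
    then show ?thesis using assms(1) us by auto
  qed
  ultimately show ?thesis by (simp add: distinct_adj_append_iff)
qed

text \<open>Up to the potential \<open>f\<close> the labels are \<open>d\<close> times those of
  \<open>w'\<close>, and the potential telescopes to zero around a cycle.\<close>

lemma flat_zero_cycle:
  assumes small: "\<And>w'. zero_cycle w' h V"
    and flat: "\<And>u v. u \<in> V \<Longrightarrow> v \<in> V \<Longrightarrow> u \<noteq> v \<Longrightarrow> d dvd w u v - f u + f v"
  shows "zero_cycle w (d * h) V"
proof -
  define w' where "w' = (\<lambda>u v. (w u v - f u + f v) div d)"
  have sum: "walk_sum w vs - f (hd vs) + f (last vs) = d * walk_sum w' vs"
    if "distinct_adj vs" "set vs \<subseteq> V" "vs \<noteq> []" for vs
    using that
  proof (induction vs rule: induct_list012)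
    case (3 u v vs)
    then have "w u v - f u + f v = d * w' u v"
      using flat[of u v] by (simp add: w'_def)
    moreover have "walk_sum w (v # vs) - f v + f (last (v # vs)) = d * walk_sum w' (v # vs)"
      using "3.IH"(2) "3.prems" by simp
    ultimately show ?case by (simp add: algebra_simps)
  qed auto
  obtain vs where vs: "set vs \<subseteq> V" "distinct vs" "2 \<le> length vs" "h dvd walk_sum w' (vs @ [hd vs])"
    using small[of w'] unfolding zero_cycle_def by blast
  then obtain u v us where us: "vs = u # v # us"
    by (auto simp: numeral_2_eq_2 Suc_le_length_iff)
  have "distinct_adj (vs @ [hd vs])" using vs(2,3) by (rule distinct_adj_closed)
  then have "walk_sum w (vs @ [hd vs]) = d * walk_sum w' (vs @ [hd vs])"
    using sum[of "vs @ [hd vs]"] vs(1) us by auto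
  then show ?thesis using vs unfolding zero_cycle_def by auto
qed

text \<open>
  The sets \<open>P z\<close> are arbitrary \<open>q\<close>-periodic sets, so that absorbing vertices is an induction on \<open>V\<close>.
\<close>

lemma zero_cycle_or_full:
  fixes w :: "'v \<Rightarrow> 'v \<Rightarrow> int" and q k :: int
  assumes q: "0 < q" "odd q"
    and smaller: "\<And>h w' (U :: 'v set). 0 < h \<Longrightarrow> h < q \<Longrightarrow> odd h \<Longrightarrow> finite U \<Longrightarrow>
      h + 1 \<le> int (card U) \<Longrightarrow> zero_cycle w' h U"
    and "finite V" "V \<noteq> {}"
    and "\<And>z. z \<in> V \<Longrightarrow> shift q (P z) = P z" "\<And>z. z \<in> V \<Longrightarrow> k \<le> density q (P z)"
    and "1 \<le> k" "q + 1 \<le> int (card V) + k"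
  shows "zero_cycle w q V \<or> (\<exists>z\<in>V. sums_from w P V z = UNIV)"
  using assms(4-)
proof (induction "card V" arbitrary: V P k rule: less_induct)
  case less
  note fin = less.prems(1) and per = less.prems(3) and dens = less.prems(4)
    and k = less.prems(5) and card = less.prems(6)
  show ?case
  proof (rule ccontr)
    assume "\<not> ?thesis"
    then have nz: "\<not> zero_cycle w q V" and nf: "\<And>z. z \<in> V \<Longrightarrow> sums_from w P V z \<noteq> UNIV"
      by auto
    \<comment> \<open>The induction hypothesis as a contradiction: \<open>V - U\<close> cannot be
      absorbed while the remaining vertices and the guaranteed residues still add up to
      \<open>q + 1\<close>.\<close>
    have step: False
      if "U \<subset> V" "U \<noteq> {}" "\<And>z. z \<in> U \<Longrightarrow> shift q (P' z) = P' z"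
        "\<And>z. z \<in> U \<Longrightarrow> k' \<le> density q (P' z)" "k \<le> k'" "q + 1 \<le> int (card U) + k'"
        "\<And>z. z \<in> U \<Longrightarrow> P' z \<subseteq> sums_from w P (insert z (V - U)) z" for U P' k'
    proof -
      have "card U < card V" "finite U"
        using that(1) fin by (auto intro: psubset_card_mono finite_subset)
      with less.hyps[of U P' k'] that k
      have "zero_cycle w q U \<or> (\<exists>z\<in>U. sums_from w P' U z = UNIV)" by force
      then show False
      proof
        assume "zero_cycle w q U"
        then show False using nz that(1) zero_cycle_mono by (metis psubset_imp_subset)
      next
        assume "\<exists>z\<in>U. sums_from w P' U z = UNIV"
        then obtain z where "z \<in> U" "sums_from w P' U z = UNIV" by blast
        with sums_from_trans[of U V P' w P z] that(1,7) have "sums_from w P V z = UNIV" by blast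
        with nf \<open>z \<in> U\<close> that(1) show False by blast
      qed
    qed
    have single: "P z \<subseteq> sums_from w P (insert z U) z" for z U
      by (auto intro!: sums_fromI[of "[z]"])
    have less_q: "P z \<noteq> UNIV" "density q (P z) < q" if "z \<in> V" for z
    proof -
      show "P z \<noteq> UNIV" using single[of z V] nf[OF that] that by (auto simp: insert_absorb)
      moreover have "shift q UNIV = UNIV" by auto
      ultimately show "density q (P z) < q"
        using density_eqD[OF per[OF that], of UNIV] q(1) density_le[of q UNIV] by force
    qed
    obtain z0 where "z0 \<in> V" using less.prems(2) by blast
    then have "k < q" using dens less_q(2) by force
    have "\<exists>z\<in>V. z \<noteq> x \<and> shift (w z x) (P x) = P z \<and> density q (P z) = k \<and> density q (P x) = k"
      if x: "x \<in> V" for x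
    proof (rule ccontr)
      assume nbad: "\<not> ?thesis"
      define P' where "P' z = P z \<union> shift (w z x) (P x)" for z
      have per': "shift q (shift g (P x)) = shift g (P x)" for g
        using per[OF x] by (simp add: shift_eq_iff)
      have P': "shift q (P' z) = P' z" if "z \<in> V" for z
        using per[OF that] per'[of "w z x"] by (simp only: P'_def shift_Un)
      show False
      proof (rule step[of "V - {x}" P' "k + 1"])
        show "V - {x} \<noteq> {}"
        proof
          assume "V - {x} = {}"
          then have "card V = card {x}" using x by (metis insert_Diff)
          with card \<open>k < q\<close> show False by simp
        qed
        \<comment> \<open>A union with only \<open>k\<close> residues would equal both its parts, as
          each has at least \<open>k\<close>; then \<open>z\<close> would be the partner that
          \<open>nbad\<close> excludes.\<close>
        show "k + 1 \<le> density q (P' z)" if z: "z \<in> V - {x}" for z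
        proof (rule ccontr)
          assume "\<not> ?thesis"
          moreover have "k \<le> density q (P z)" "k \<le> density q (shift (w z x) (P x))"
            using dens z x per q by auto
          moreover have "density q (P z) \<le> density q (P' z)"
            "density q (shift (w z x) (P x)) \<le> density q (P' z)"
            unfolding P'_def by (auto intro: density_mono)
          ultimately have "P z = P' z" "shift (w z x) (P x) = P' z"
            "density q (P z) = k" "density q (shift (w z x) (P x)) = k"
            using density_eqD[OF per P' q(1)] density_eqD[OF per'[of "w z x"] P' q(1)] z
            by (auto simp: P'_def)
          moreover from this have "density q (P x) = k"
            using density_shift[OF q(1) per[OF x], of "w z x"] by simp
          ultimately show False using nbad z by (metis Diff_iff insertI1)
        qed
        show "P' z \<subseteq> sums_from w P (insert z (V - (V - {x}))) z" if "z \<in> V - {x}" for z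
          using that x single[of z]
          by (auto simp: P'_def intro!: sums_fromI[of "[z, x]"])
        show "q + 1 \<le> int (card (V - {x})) + (k + 1)"
          using card x fin card_gt_0_iff[of V] by (simp add: of_nat_diff Suc_leI) 
      qed (use x P' in auto)
    qed
    then obtain b where b: "\<And>x. x \<in> V \<Longrightarrow> b x \<in> V" "\<And>x. x \<in> V \<Longrightarrow> b x \<noteq> x"
      "\<And>x. x \<in> V \<Longrightarrow> shift (w (b x) x) (P x) = P (b x)" "\<And>x. x \<in> V \<Longrightarrow> density q (P x) = k"
      by metis
    obtain vs where vs: "set vs \<subseteq> V" "distinct vs" "2 \<le> length vs"
      "shift (walk_sum w (vs @ [hd vs])) (P (hd vs)) = P (hd vs)"
      using translation_cycle[of V b w P] fin less.prems(2) b(1-3) by blast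
    \<comment> \<open>Two vertices are needed as entrances. \<open>P z\<close> is a translate of
      \<open>P x\<close>, so both have the same stabiliser.\<close>
    define x z where "x = hd vs" and "z = b x"
    have "vs \<noteq> []" using vs(3) by auto
    then have x: "x \<in> V" using vs(1) by (auto simp: x_def)
    then have z: "z \<in> V" "z \<noteq> x" using b by (auto simp: z_def)
    obtain d where d: "0 < d" "\<And>g. shift g (P x) = P x \<longleftrightarrow> d dvd g"
      using stabilizer_generator[OF q(1) per[OF x]] by blast
    have dz: "shift g (P z) = P z \<longleftrightarrow> d dvd g" for g
      unfolding z_def b(3)[OF x, symmetric] by (simp add: shift_eq_iff d(2))
    have "d dvd q" using d(2) per[OF x] by blast
    then obtain h where h: "q = d * h" by blast
    have "d \<noteq> q" using nz vs d(2) unfolding zero_cycle_def x_def by blast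
    have "0 < h" using h d(1) q(1) by (simp add: zero_less_mult_iff)
    moreover have "h \<noteq> 1" using \<open>d \<noteq> q\<close> h by auto
    moreover have "odd h" using h q(2) by simp
    \<comment> \<open>Oddness excludes \<open>h = 2\<close>; a gain of \<open>h\<close> residues
      thus pays for three vertices.\<close>
    ultimately have h3: "3 \<le> h" by presburger
    have dx: "shift d (P x) = P x" by (simp add: d(2))
    \<comment> \<open>A proper \<open>d\<close>-periodic subset misses a whole class modulo
      \<open>d\<close>. Hence \<open>card V\<close> is at least \<open>h + 1\<close>, enough to
      remove three vertices and to apply \<open>smaller\<close> to \<open>h\<close>.\<close>
    have kh: "k + h \<le> q"
    proof -
      have "P x \<subset> UNIV" "shift d UNIV = UNIV" using less_q(1)[OF x] by auto
      then have "density q (P x) + h \<le> density q UNIV"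
        unfolding h using density_less[OF d(1) dx] \<open>0 < h\<close> by simp
      then show ?thesis using b(4)[OF x] density_le[of q UNIV] q(1) by simp
    qed
    have "h < q"  using kh k by simp
    \<comment> \<open>If this fails, then replacing \<open>P t\<close> by the sums of the walks from \<open>t\<close> over \<open>u\<close> to \<open>y\<close>, with
      or without the detour over \<open>v\<close>, removes \<open>u\<close>, \<open>v\<close>, \<open>y\<close> and gains \<open>h \<ge> 3\<close> residues.\<close>
    have gate: "d dvd w u v + w v y - w u y"
      if y: "y \<in> V" "\<And>g. shift g (P y) = P y \<longleftrightarrow> d dvd g"
        and uv: "u \<in> V" "v \<in> V" "u \<noteq> v" "u \<noteq> y" "v \<noteq> y" for y u v
    proof (rule ccontr)
      assume e: "\<not> ?thesis"
      define A B where "A = shift (w u y) (P y)" and "B = shift (w u v + w v y) (P y)"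
      have dA: "shift d A = A" "shift d B = B"
        using y(2)[of d] by (simp_all add: A_def B_def shift_eq_iff)
      then have qA: "shift q A = A" "shift q B = B"
        using \<open>d dvd q\<close> shift_dvd by blast+
      \<comment> \<open>The two label sums differ by a number outside the stabiliser of
        \<open>P y\<close>. Having equal density, neither of \<open>A\<close> and \<open>B\<close>
        contains the other.\<close>
      have "A \<noteq> B"
        using e y(2) by (auto simp: A_def B_def shift_eq_iff dvd_diff_commute)
      moreover have dens_AB: "density q A = k" "density q B = k"
        using q(1) per[OF y(1)] b(4)[OF y(1)] by (auto simp: A_def B_def)
      ultimately have "A \<subset> A \<union> B"
        using density_eqD[OF qA(2,1) q(1)] by auto
      then have AB: "k + h \<le> density q (A \<union> B)"
        using density_less[of d A "A \<union> B" h] d(1) dA \<open>0 < h\<close> dens_AB by (simp add: h shift_Un)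
      have c: "card V = card (V - {y, u, v}) + 3"
      proof -
        have "card {y, u, v} = 3" using uv by auto
        then show ?thesis using fin y(1) uv(1,2)
          by (subst card_Diff_subset) (auto dest: card_mono[of V "{y, u, v}"])
      qed
      show False
      proof (rule step[of "V - {y, u, v}" "\<lambda>t. shift (w t u) (A \<union> B)" "k + h"])
        have "0 < card (V - {y, u, v})" using c card kh h3 by linarith
        then show "V - {y, u, v} \<noteq> {}" by (metis card.empty less_irrefl)
        fix t assume t: "t \<in> V - {y, u, v}"
        have qAB: "shift q (A \<union> B) = A \<union> B" using qA by (simp add: shift_Un)
        then show "shift q (shift (w t u) (A \<union> B)) = shift (w t u) (A \<union> B)"
          by (simp add: shift_eq_iff)
        show "k + h \<le> density q (shift (w t u) (A \<union> B))"
          using AB q(1) qAB by simp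
        have VU: "V - (V - {y, u, v}) = {y, u, v}" using y(1) uv by auto
        show "shift (w t u) (A \<union> B) \<subseteq> sums_from w P (insert t (V - (V - {y, u, v}))) t"
        proof
          fix r assume "r \<in> shift (w t u) (A \<union> B)"
          then consider "r - w t u - w u y \<in> P y" | "r - w t u - (w u v + w v y) \<in> P y"
            by (auto simp: A_def B_def)
          then show "r \<in> sums_from w P (insert t (V - (V - {y, u, v}))) t"
          proof cases
            case 1
            then show ?thesis using t uv unfolding VU
              by (intro sums_fromI[of "[t, u, y]"]) (auto simp: algebra_simps)
          next
            case 2
            then show ?thesis using t uv unfolding VU
              by (intro sums_fromI[of "[t, u, v, y]"]) (auto simp: algebra_simps)
          qed
        qed
      qed (use y uv c card kh h3 in auto)
    qed
    note gx = gate[OF x d(2)] and gz = gate[OF z(1) dz]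
    \<comment> \<open>The potential is the label of the arc into \<open>x\<close>, and
      \<open>0\<close> at \<open>x\<close>, where there is no arc. Flatness away from
      \<open>x\<close> is \<open>gx\<close>, arcs into \<open>x\<close> are trivially flat, and arcs
      out of \<open>x\<close> need \<open>xv\<close>.\<close>
    define f where "f u = (if u = x then 0 else w u x)" for u
    \<comment> \<open>\<open>gx\<close> involves no arc leaving \<open>x\<close>. Adding one
      relation for each entrance, with a third vertex \<open>t\<close>, cancels all labels at
      \<open>t\<close>.\<close>
    have xz: "d dvd w x z + w z x"
    proof -
      have "card V > card {x, z}" using card kh h3 z by auto
      then obtain t where "t \<in> V" "t \<noteq> x" "t \<noteq> z"
        by (metis card_mono finite.emptyI finite.insertI insertI1 insertI2 leD subsetI)
      then have "d dvd (w t x + w x z - w t z) + (w t z + w z x - w t x)"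
        using x z gz[of t x] gx[of t z] by (intro dvd_add) auto
      then show ?thesis by simp
    qed
    have xv: "d dvd w x v + w v x" if "v \<in> V" "v \<noteq> x" for v
    proof (cases "v = z")
      case False
      then have "d dvd w x v + w v z - w x z" "d dvd w v z + w z x - w v x"
        using x z that by (auto intro!: gz gx)
      then have "d dvd (w x v + w v z - w x z) - (w v z + w z x - w v x) + (w x z + w z x)"
        using xz by (metis dvd_add dvd_diff)
      then show ?thesis by simp
    qed (use xz in simp)
    have "zero_cycle w (d * h) V"
    proof (rule flat_zero_cycle[where f = f])
      show "zero_cycle w' h V" for w'
        using smaller[of h V w'] \<open>0 < h\<close> \<open>h < q\<close> \<open>odd h\<close> fin card kh by auto
      show "d dvd w u v - f u + f v" if "u \<in> V" "v \<in> V" "u \<noteq> v" for u v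
        using that gx[of u v] xv[of v] by (auto simp: f_def algebra_simps)
    qed
    with nz h show False by simp
  qed
qed

text \<open>Strong induction supplies the smaller moduli. Removing a root leaves at least
  \<open>q\<close> vertices with one residue each, which is the balance \<open>q + 1\<close> that
  absorption starts from.\<close>

theorem zero_cycle_of_odd_order:
  fixes w :: "'v \<Rightarrow> 'v \<Rightarrow> int"
  assumes "0 < q" "odd q" "finite V" "q + 1 \<le> int (card V)"
  shows "zero_cycle w q V"
  using assms
proof (induction "nat q" arbitrary: q w V rule: less_induct)
  case less
  note q = less.prems
  have "V \<noteq> {}" using q by auto
  then obtain y where y: "y \<in> V" by blast
  define P where "P z = {r. q dvd r - w z y}" for z
  have cV: "card V = Suc (card (V - {y}))" using q(3) y by (metis card.remove)
  have "zero_cycle w q (V - {y}) \<or> (\<exists>z\<in>V - {y}. sums_from w P (V - {y}) z = UNIV)"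
  proof (rule zero_cycle_or_full[where k = 1])
    show "V - {y} \<noteq> {}" using cV q by (metis card.empty of_nat_1 One_nat_def add_le_same_cancel2 not_le)
    have "q dvd r - q - w z y \<longleftrightarrow> q dvd r - w z y" for r z
      using dvd_add_triv_right_iff[of q "r - q - w z y"] by simp
    then show "shift q (P z) = P z" for z by (auto simp: P_def)
    show "1 \<le> density q (P z)" for z
    proof -
      have "w z y mod q \<in> P z \<inter> {0..<q}"
        using q(1) by (simp add: P_def mod_eq_dvd_iff[symmetric])
      then have "0 < card (P z \<inter> {0..<q})" by (metis card_gt_0_iff empty_iff finite_Int finite_atLeastLessThan_int)
      then show ?thesis by (simp add: density_def)
    qed
    show "zero_cycle w' h U" if "0 < h" "h < q" "odd h" "finite U" "h + 1 \<le> int (card U)"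
      for h w' and U :: "'v set"
      using less.hyps[of h U w'] that by simp
  qed (use q cV in auto)
  then show ?case
  proof
    assume "zero_cycle w q (V - {y})"
    then show ?thesis by (rule zero_cycle_mono) auto
  next
    assume "\<exists>z\<in>V - {y}. sums_from w P (V - {y}) z = UNIV"
    \<comment> \<open>A path from \<open>z\<close> to the root with this residue is closed by the
      arc from \<open>y\<close> to \<open>z\<close>.\<close>
    then obtain z where "- w y z \<in> sums_from w P (V - {y}) z" by blast
    then obtain vs where vs: "set vs \<subseteq> V - {y}" "distinct vs" "vs \<noteq> []" "hd vs = z"
      "- w y z - walk_sum w vs \<in> P (last vs)"
      unfolding sums_from_def by blast
    obtain us where us: "vs = z # us" using vs(3,4) by (cases vs) auto
    have eq: "- (w y z + walk_sum w vs + w (last vs) y) = - w y z - walk_sum w vs - w (last vs) y"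
      by simp
    have "q dvd - (w y z + walk_sum w vs + w (last vs) y)"
      unfolding eq using vs(5) by (simp only: P_def mem_Collect_eq)
    moreover have "walk_sum w ((y # vs) @ [hd (y # vs)]) = w y z + walk_sum w vs + w (last vs) y"
      using walk_sum_append[of "y # vs" w "[y]"] us by simp
    ultimately have "q dvd walk_sum w ((y # vs) @ [hd (y # vs)])"
      by (metis dvd_minus_iff)
    then show ?thesis
      unfolding zero_cycle_def using vs us y by (intro exI[of _ "y # vs"]) auto
  qed
qed

subsection \<open>From branch sets to a labelled digraph\<close>

text \<open>Symmetry gives strong connectedness, hence a path inside \<open>B\<close>. Its tails are
  all its vertices except the end, so a vertex joining two walks is counted once.\<close>

lemma (in sym_digraph) connected_inner_walk:
  assumes "connected (G \<restriction> B)" "B \<subseteq> verts G" "u \<in> B" "v \<in> B"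
  obtains p where "awalk u p v" "distinct (map (tail G) p)" "tail G ` set p \<subseteq> B - {v}"
proof -
  let ?H = "G \<restriction> B"
  interpret H: wf_digraph ?H ..
  have sub: "induced_subgraph ?H G" using assms(2) by (rule induced_induce)
  then have "symmetric ?H" using sym_arcs by (rule induced_graph_imp_symmetric[rotated])
  then have "strongly_connected ?H"
    using assms(1) by (rule H.symmetric_connected_imp_strongly_connected)
  then have "u \<rightarrow>\<^sup>*\<^bsub>?H\<^esub> v" using assms(3,4) by (auto simp: strongly_connected_def)
  then obtain p where p: "H.apath u p v" by (auto simp: H.reachable_apath)
  have verts: "H.awalk_verts u p = map (tail G) p @ [v]"
    using p H.awalk_verts_conv[of u p] by (cases "p = []") (auto simp: H.apath_def)
  have "awalk u p v"
    using p sub by (auto simp: H.apath_def intro: subgraph_awalk_imp_awalk)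
  moreover have "distinct (H.awalk_verts u p)" using p by (simp add: H.apath_def)
  moreover have "set (H.awalk_verts u p) \<subseteq> verts ?H"
    using H.awalkI_apath[OF p] by (rule H.awalkE)
  ultimately show thesis unfolding verts using that by auto
qed

fun concat_links :: "('i \<Rightarrow> 'i \<Rightarrow> 'b list) \<Rightarrow> 'i list \<Rightarrow> 'b list" where
  "concat_links L (i # j # ks) = L i j @ concat_links L (j # ks)"
| "concat_links L ks = []"

lemma length_concat_links:
  "int (length (concat_links L ks)) = walk_sum (\<lambda>i j. int (length (L i j))) ks"
  by (induction L ks rule: concat_links.induct) auto

text \<open>Each index is left at most once, through \<open>B i\<close>, and entered at most once,
  through \<open>A j\<close>, so no part is used twice. Distinctness is asked of
  \<open>butlast ks\<close> and \<open>tl ks\<close> because a closed list repeats its first index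
  at the end.\<close>

lemma (in wf_digraph) concat_links:
  assumes link: "\<And>i j. i \<in> I \<Longrightarrow> j \<in> I \<Longrightarrow> i \<noteq> j \<Longrightarrow> awalk (b i) (L i j) (b j)"
      "\<And>i j. i \<in> I \<Longrightarrow> j \<in> I \<Longrightarrow> i \<noteq> j \<Longrightarrow> distinct (map (tail G) (L i j))"
      "\<And>i j. i \<in> I \<Longrightarrow> j \<in> I \<Longrightarrow> i \<noteq> j \<Longrightarrow> tail G ` set (L i j) \<subseteq> B i \<union> A j"
    and disj: "\<And>i j. i \<in> I \<Longrightarrow> j \<in> I \<Longrightarrow> i \<noteq> j \<Longrightarrow> A i \<inter> A j = {}"
      "\<And>i j. i \<in> I \<Longrightarrow> j \<in> I \<Longrightarrow> i \<noteq> j \<Longrightarrow> B i \<inter> B j = {}"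
      "\<And>i j. i \<in> I \<Longrightarrow> j \<in> I \<Longrightarrow> A i \<inter> B j = {}"
    and b: "\<And>i. i \<in> I \<Longrightarrow> b i \<in> verts G"
    and ks: "ks \<noteq> []" "set ks \<subseteq> I" "distinct_adj ks" "distinct (butlast ks)" "distinct (tl ks)"
  shows "awalk (b (hd ks)) (concat_links L ks) (b (last ks)) \<and>
    distinct (map (tail G) (concat_links L ks)) \<and>
    tail G ` set (concat_links L ks) \<subseteq> (\<Union>i\<in>set (butlast ks). B i) \<union> (\<Union>j\<in>set (tl ks). A j)"
  using ks
proof (induction ks rule: induct_list012)
  case (2 i)
  then show ?case using b by (simp add: awalk_Nil_iff)
next
  case (3 i j ks)
  let ?W = "concat_links L (j # ks)"
  have ij: "i \<in> I" "j \<in> I" "i \<noteq> j" "set ks \<subseteq> I" using "3.prems" by auto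
  have IH: "awalk (b j) ?W (b (last (j # ks)))" "distinct (map (tail G) ?W)"
    "tail G ` set ?W \<subseteq> (\<Union>i\<in>set (butlast (j # ks)). B i) \<union> (\<Union>j\<in>set ks. A j)"
    using "3.IH"(2) "3.prems" by (auto dest: distinct_tl)
  have nin: "i \<notin> set (butlast (j # ks))" "j \<notin> set ks" using "3.prems" by auto
  have sub: "set (butlast (j # ks)) \<subseteq> I" using "3.prems" by (auto dest: in_set_butlastD)
  have "(B i \<union> A j) \<inter> ((\<Union>i\<in>set (butlast (j # ks)). B i) \<union> (\<Union>j\<in>set ks. A j)) = {}"
    (is "_ \<inter> ?R = _")
  proof -
    have "B i \<inter> B l = {}" "A j \<inter> B l = {}" if "l \<in> set (butlast (j # ks))" for l
      using disj(2)[of i l] disj(3)[of j l] ij nin(1) sub that by blast+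
    moreover have "A j \<inter> A l = {}" "A l \<inter> B i = {}" if "l \<in> set ks" for l
      using disj(1)[of j l] disj(3)[of l i] ij nin(2) that by blast+
    ultimately show ?thesis by blast
  qed
  moreover have "tail G ` set (L i j) \<inter> tail G ` set ?W \<subseteq> (B i \<union> A j) \<inter> ?R"
    using link(3)[OF ij(1-3)] IH(3) by (rule Int_mono)
  ultimately have disjoint: "tail G ` set (L i j) \<inter> tail G ` set ?W = {}"
    by (simp only: subset_empty)
  have "tail G ` set (concat_links L (i # j # ks)) \<subseteq> B i \<union> A j \<union> ?R"
    unfolding concat_links.simps set_append image_Un using link(3)[OF ij(1-3)] IH(3)
    by (rule Un_mono)
  also have "\<dots> = (\<Union>i\<in>set (butlast (i # j # ks)). B i) \<union> (\<Union>j\<in>set (tl (i # j # ks)). A j)"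
    by auto
  finally have tails: "tail G ` set (concat_links L (i # j # ks)) \<subseteq> \<dots>" .
  have "awalk (b i) (L i j @ ?W) (b (last (j # ks)))"
    using link(1)[OF ij(1-3)] IH(1) by (simp add: awalk_appendI)
  moreover have "distinct (map (tail G) (L i j @ ?W))"
    using link(2)[OF ij(1-3)] IH(2) disjoint by simp
  ultimately show ?case using tails by simp
qed simp

text \<open>\<open>cycle\<close> asks for distinct heads; around a closed walk these are the tails
  rotated by one place.\<close>

lemma (in wf_digraph) cycleI_distinct_tails:
  assumes "awalk u p u" "p \<noteq> []" "distinct (map (tail G) p)"
  shows "cycle p"
proof -
  have cas: "cas u p u" using assms(1) by auto
  have "map (tail G) p @ [u] = u # map (head G) p"
    using awalk_verts_conv[of u p] awalk_verts_conv'[OF cas] awlast_if_cas[OF cas] assms(2) cas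
    by (simp add: cas_simp)
  then have "mset (map (tail G) p @ [u]) = mset (u # map (head G) p)" by (rule arg_cong)
  then have "mset (map (tail G) p) = mset (map (head G) p)" by simp
  then have "distinct (map (head G) p)" using assms(3) mset_eq_imp_distinct_iff by blast
  then show ?thesis
    unfolding cycle_def using assms awalk_verts_conv'[OF cas] by (intro exI[of _ u]) auto
qed

theorem corollary1p2:
  fixes G :: "('a,'b) pre_digraph" and K :: "('c,'d) pre_digraph" and q :: nat
  assumes "odd q"
    and "simple_graph G"
    and "complete_digraph (2 * q + 2) K"
    and "minor_of K G"
  shows "\<exists>p. undirected_cycle G p \<and> q dvd length p"
proof -
  interpret simple_graph G by fact
  from assms(3) have K: "card (verts K) = 2 * q + 2"
    "\<And>x y. x \<in> verts K \<Longrightarrow> y \<in> verts K \<Longrightarrow> x \<noteq> y \<Longrightarrow> x \<rightarrow>\<^bsub>K\<^esub> y"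
    by (auto simp: complete_digraph_def)
  obtain M where "\<forall>x\<in>verts K. M x \<subseteq> verts G \<and> connected (G \<restriction> M x)"
      "\<forall>x\<in>verts K. \<forall>y\<in>verts K. x \<noteq> y \<longrightarrow> M x \<inter> M y = {}"
      "\<forall>x y. x \<rightarrow>\<^bsub>K\<^esub> y \<longrightarrow> (\<exists>u\<in>M x. \<exists>v\<in>M y. u \<rightarrow>\<^bsub>G\<^esub> v)"
    using assms(4) unfolding minor_of_def by (elim exE conjE)
  then have M: "\<And>x. x \<in> verts K \<Longrightarrow> M x \<subseteq> verts G"
      "\<And>x. x \<in> verts K \<Longrightarrow> connected (G \<restriction> M x)"
      "\<And>x y. x \<in> verts K \<Longrightarrow> y \<in> verts K \<Longrightarrow> x \<noteq> y \<Longrightarrow> M x \<inter> M y = {}"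
      "\<And>x y. x \<rightarrow>\<^bsub>K\<^esub> y \<Longrightarrow> \<exists>u\<in>M x. \<exists>v\<in>M y. u \<rightarrow>\<^bsub>G\<^esub> v"
    by simp_all
  have "finite (verts K)" using K(1) by (simp add: card_ge_0_finite)
  then obtain g where "bij_betw g {..<2 * q + 2} (verts K)"
    using ex_bij_betw_nat_finite[of "verts K"] K(1) by (auto simp: atLeast0LessThan)
  then have g: "\<And>n. n < 2 * q + 2 \<Longrightarrow> g n \<in> verts K"
    "\<And>m n. m < 2 * q + 2 \<Longrightarrow> n < 2 * q + 2 \<Longrightarrow> g m = g n \<Longrightarrow> m = n"
    by (auto simp: bij_betw_def inj_on_def)
  define I where "I = {..q}"
  define A B where "A i = M (g (2 * i))" and "B i = M (g (2 * i + 1))" for i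
  have idx: "2 * i < 2 * q + 2" "2 * i + 1 < 2 * q + 2" if "i \<in> I" for i
    using that by (auto simp: I_def)
  have AK: "g (2 * i) \<in> verts K" and BK: "g (2 * i + 1) \<in> verts K" if "i \<in> I" for i
    using g(1) idx[OF that] by auto
  have ne: "g (2 * i + 1) \<noteq> g (2 * j)" if "i \<in> I" "j \<in> I" for i j
  proof
    assume "g (2 * i + 1) = g (2 * j)"
    then have "2 * i + 1 = 2 * j" using g(2) idx that by blast
    then show False by presburger
  qed
  have disj: "A i \<inter> A j = {}" "B i \<inter> B j = {}" if "i \<in> I" "j \<in> I" "i \<noteq> j" for i j
    using M(3) AK BK that g(2)[of "2 * i" "2 * j"] g(2)[of "2 * i + 1" "2 * j + 1"] idx
    unfolding A_def B_def by auto
  have disj': "A i \<inter> B j = {}" if "i \<in> I" "j \<in> I" for i j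
    using M(3)[OF AK BK, of i j] ne[of j i] that unfolding A_def B_def by auto
  have arc: "\<exists>e\<in>arcs G. tail G e \<in> B i \<and> head G e \<in> A j" if "i \<in> I" "j \<in> I" for i j
    using M(4)[OF K(2)[OF BK AK ne], of i j] that unfolding A_def B_def
    by (auto simp: arcs_ends_conv)
  have arc_back: "\<exists>f\<in>arcs G. tail G f \<in> A i \<and> head G f \<in> B i" if "i \<in> I" for i
    using M(4)[OF K(2)[OF AK BK ne[symmetric]], of i i] that unfolding A_def B_def
    by (auto simp: arcs_ends_conv)
  then obtain f where f: "\<And>i. i \<in> I \<Longrightarrow> f i \<in> arcs G" "\<And>i. i \<in> I \<Longrightarrow> tail G (f i) \<in> A i"
    "\<And>i. i \<in> I \<Longrightarrow> head G (f i) \<in> B i"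
    by metis
  define b where "b i = head G (f i)" for i
  \<comment> \<open>The length bound ensures at least three arcs even if the index cycle has only
    two vertices.\<close>
  define link where "link i j p \<longleftrightarrow> awalk (b i) p (b j) \<and> distinct (map (tail G) p) \<and>
      tail G ` set p \<subseteq> B i \<union> A j \<and> 2 \<le> length p" for i j p
  have ex_link: "\<exists>p. link i j p" if ij: "i \<in> I" "j \<in> I" for i j
  proof -
    obtain e where e: "e \<in> arcs G" "tail G e \<in> B i" "head G e \<in> A j" using arc ij by blast
    obtain p1 where p1: "awalk (b i) p1 (tail G e)" "distinct (map (tail G) p1)"
      "tail G ` set p1 \<subseteq> B i - {tail G e}"
      using connected_inner_walk[of "B i" "b i" "tail G e"] M(1,2) BK ij f(3) e unfolding B_def b_def
      by blast
    obtain p2 where p2: "awalk (head G e) p2 (tail G (f j))" "distinct (map (tail G) p2)"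
      "tail G ` set p2 \<subseteq> A j - {tail G (f j)}"
      using connected_inner_walk[of "A j" "head G e" "tail G (f j)"] M(1,2) AK ij f(2) e unfolding A_def
      by blast
    \<comment> \<open>Through \<open>B i\<close>, across \<open>e\<close>, through
      \<open>A j\<close>, across \<open>f j\<close>. The inner walks avoid the tails of
      \<open>e\<close> and \<open>f j\<close>, so all tails are distinct.\<close>
    let ?p = "p1 @ e # p2 @ [f j]"
    have "awalk (b i) ?p (b j)"
      using p1(1) p2(1) e(1) f(1)[OF ij(2)] by (auto simp: awalk_Cons_iff awalk_Nil_iff arc_to_ends_def b_def)
    moreover have "distinct (map (tail G) ?p)"
      using p1(2,3) p2(2,3) e(2) f(2)[OF ij(2)] disj'[OF ij(2,1)] by auto
    moreover have "tail G ` set ?p \<subseteq> B i \<union> A j"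
      using p1(3) p2(3) e(2) f(2)[OF ij(2)] by auto
    ultimately show ?thesis unfolding link_def by (intro exI[of _ ?p]) auto
  qed
  define L where "L i j = (SOME p. link i j p)" for i j
  have "link i j (L i j)" if "i \<in> I" "j \<in> I" for i j
    unfolding L_def using ex_link[OF that] by (rule someI_ex)
  then have L: "\<And>i j. i \<in> I \<Longrightarrow> j \<in> I \<Longrightarrow> awalk (b i) (L i j) (b j)"
    "\<And>i j. i \<in> I \<Longrightarrow> j \<in> I \<Longrightarrow> distinct (map (tail G) (L i j))"
    "\<And>i j. i \<in> I \<Longrightarrow> j \<in> I \<Longrightarrow> tail G ` set (L i j) \<subseteq> B i \<union> A j"
    "\<And>i j. i \<in> I \<Longrightarrow> j \<in> I \<Longrightarrow> 2 \<le> length (L i j)"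
    by (simp_all add: link_def)
  have "zero_cycle (\<lambda>i j. int (length (L i j))) (int q) I"
    using assms(1) by (intro zero_cycle_of_odd_order) (auto simp: I_def elim: oddE)
  then obtain vs where vs: "set vs \<subseteq> I" "distinct vs" "2 \<le> length vs"
    "int q dvd walk_sum (\<lambda>i j. int (length (L i j))) (vs @ [hd vs])"
    unfolding zero_cycle_def by blast
  let ?p = "concat_links L (vs @ [hd vs])"
  have "q dvd length ?p" using vs(4) by (simp flip: length_concat_links)
  obtain i j us where ij: "vs = i # j # us"
    using vs(3) by (auto simp: numeral_2_eq_2 Suc_le_length_iff)
  have "distinct_adj (vs @ [hd vs])" using vs(2,3) by (rule distinct_adj_closed)
  then have "awalk (b i) ?p (b i) \<and> distinct (map (tail G) ?p)"
    using concat_links[of I b L B A "vs @ [hd vs]"] L disj disj' f(1) vs(1,2) ij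
    by (auto simp: b_def)
  moreover have "3 \<le> length ?p"
  proof -
    obtain k ks where k: "us @ [i] = k # ks" by (cases "us @ [i]") auto
    then have "k \<in> set (us @ [i])" by simp
    then have "k \<in> I" using vs(1) ij by auto
    with k show ?thesis using L(4)[of i j] L(4)[of j k] ij vs(1) by simp
  qed
  moreover from this have "?p \<noteq> []" by auto
  ultimately have "undirected_cycle G ?p"
    unfolding undirected_cycle_def by (intro conjI cycleI_distinct_tails[of "b i"]) simp_all
  with \<open>q dvd length ?p\<close> show ?thesis by blast
qed

end
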